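(* Let $G$ be a graph on $n$ vertices and $N\subseteq V(G)$ an independent set such that $\operatorname{Z}(G^{N})=2$. Then $\operatorname{Z}(G^{N})=\operatorname{M}(G^{N})=2$ and $G$ is a graph of two parallel paths; moreover, if $|N|\le 1$ then $G$ is not a path graph.
   Context: Graphs are finite, simple and undirected. For a graph $G$, $\mathcal S(G)$ is the set of real symmetric matrices indexed by $V(G)$ whose off-diagonal $ij$ entry is nonzero if and only if $ij\in E(G)$; diagonal entries are arbitrary. A probe graph $G^{N}$ is a graph $G$ with an independent set $N\subseteq V(G)$ of non-probe vertices; the other vertices are probe vertices. $\mathcal S(G^{N})$ is the union of $\mathcal S(H)$ over all graphs $H$ obtained from $G$ by adding any number of edges between vertices of $N$. $\operatorname{M}(G^{N})$ is the maximum nullity of a matrix in $\mathcal S(G^{N})$. Probe graph color change rule, for a current set $B$ of blue vertices (others white; adjacency is in $G$): (1) if $v\in B$ is a probe vertex with exactly one white neighbor $w$, then $v$ forces $w$ to become blue; (2) if $N\subseteq B$ and $u\in N$ has exactly one white neighbor $w$, then $u$ forces $w$ to become blue. A set of initially blue vertices is a probe graph zero forcing set if repeated application of the rule eventually colors all of $V(G)$ blue. $\operatorname{Z}(G^{N})$ is the minimum cardinality of a probe graph zero forcing set. A graph $G$ on $n$ vertices is a graph of two parallel paths if there exist two vertex-disjoint induced paths $v_1\dots v_k$ and $u_1\dots u_\ell$ in $G$ with $k+\ell=n$ such that whenever $v_iu_j\in E(G)$, $v_xu_y$ is not an edge when $x>i,\ y<j$ or $x<i,\ y>j$. By convention this includes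 the case that $G$ is a path $P_n$. *)

theory Defs
  imports "HOL-Analysis.Analysis"
begin

text \<open>
  A graph has vertex set the whole finite type \<open>'v\<close> and is given by its adjacency relation, so that
  \<open>n = CARD('v)\<close> and matrices indexed by the vertices are elements of \<open>real ^ 'v ^ 'v\<close>.
\<close>

definition simple_graph :: "('v \<Rightarrow> 'v \<Rightarrow> bool) \<Rightarrow> bool" where
  "simple_graph E \<longleftrightarrow> symp E \<and> irreflp E"

definition independent_set :: "('v \<Rightarrow> 'v \<Rightarrow> bool) \<Rightarrow> 'v set \<Rightarrow> bool" where
  "independent_set E N \<longleftrightarrow> (\<forall>u\<in>N. \<forall>v\<in>N. \<not> E u v)"

definition graph_matrices :: "('v::finite \<Rightarrow> 'v \<Rightarrow> bool) \<Rightarrow> (real ^ 'v ^ 'v) set" where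
  "graph_matrices E = {A. transpose A = A \<and> (\<forall>i j. i \<noteq> j \<longrightarrow> (A $ i $ j \<noteq> 0 \<longleftrightarrow> E i j))}"

definition probe_completions :: "('v \<Rightarrow> 'v \<Rightarrow> bool) \<Rightarrow> 'v set \<Rightarrow> ('v \<Rightarrow> 'v \<Rightarrow> bool) set" where
  "probe_completions E N =
    {H. simple_graph H \<and> (\<forall>u v. E u v \<longrightarrow> H u v)
      \<and> (\<forall>u v. H u v \<and> \<not> E u v \<longrightarrow> u \<in> N \<and> v \<in> N)}"

definition probe_matrices :: "('v::finite \<Rightarrow> 'v \<Rightarrow> bool) \<Rightarrow> 'v set \<Rightarrow> (real ^ 'v ^ 'v) set" where
  "probe_matrices E N = (\<Union>H\<in>probe_completions E N. graph_matrices H)"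

definition nullity :: "real ^ 'n ^ 'm \<Rightarrow> nat" where
  "nullity A = dim {x. A *v x = 0}"

definition probe_max_nullity :: "('v::finite \<Rightarrow> 'v \<Rightarrow> bool) \<Rightarrow> 'v set \<Rightarrow> nat" where
  "probe_max_nullity E N = Max (nullity ` probe_matrices E N)"

definition probe_forces ::
    "('v \<Rightarrow> 'v \<Rightarrow> bool) \<Rightarrow> 'v set \<Rightarrow> 'v set \<Rightarrow> 'v \<Rightarrow> 'v \<Rightarrow> bool" where
  "probe_forces E N B v w \<longleftrightarrow>
    {x. E v x \<and> x \<notin> B} = {w} \<and> (v \<in> B \<and> v \<notin> N \<or> N \<subseteq> B \<and> v \<in> N)"

definition probe_step :: "('v \<Rightarrow> 'v \<Rightarrow> bool) \<Rightarrow> 'v set \<Rightarrow> 'v set \<Rightarrow> 'v set \<Rightarrow> bool" where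
  "probe_step E N B B' \<longleftrightarrow> (\<exists>v w. probe_forces E N B v w \<and> B' = insert w B)"

definition probe_zero_forcing_set :: "('v \<Rightarrow> 'v \<Rightarrow> bool) \<Rightarrow> 'v set \<Rightarrow> 'v set \<Rightarrow> bool" where
  "probe_zero_forcing_set E N B \<longleftrightarrow> (probe_step E N)\<^sup>*\<^sup>* B UNIV"

definition probe_zero_forcing_number :: "('v::finite \<Rightarrow> 'v \<Rightarrow> bool) \<Rightarrow> 'v set \<Rightarrow> nat" where
  "probe_zero_forcing_number E N = Min (card ` {B. probe_zero_forcing_set E N B})"

definition induced_path :: "('v \<Rightarrow> 'v \<Rightarrow> bool) \<Rightarrow> 'v list \<Rightarrow> bool" where
  "induced_path E vs \<longleftrightarrow> vs \<noteq> [] \<and> distinct vs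
    \<and> (\<forall>i<length vs. \<forall>j<length vs. E (vs ! i) (vs ! j) \<longleftrightarrow> j = Suc i \<or> i = Suc j)"

definition path_graph :: "('v \<Rightarrow> 'v \<Rightarrow> bool) \<Rightarrow> bool" where
  "path_graph E \<longleftrightarrow> (\<exists>vs. induced_path E vs \<and> set vs = UNIV)"

text \<open>The second disjunct matters only for the one-vertex path, as both paths are nonempty.\<close>

definition two_parallel_paths :: "('v::finite \<Rightarrow> 'v \<Rightarrow> bool) \<Rightarrow> bool" where
  "two_parallel_paths E \<longleftrightarrow>
    (\<exists>vs us. induced_path E vs \<and> induced_path E us \<and> set vs \<inter> set us = {}
      \<and> length vs + length us = CARD('v)
      \<and> (\<forall>i<length vs. \<forall>j<length us. E (vs ! i) (us ! j) \<longrightarrow>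
           (\<forall>x<length vs. \<forall>y<length us.
              (x > i \<and> y < j) \<or> (x < i \<and> y > j) \<longrightarrow> \<not> E (vs ! x) (us ! y))))
    \<or> path_graph E"

text \<open>The \<open>Max\<close> and \<open>Min\<close> above are taken over finite nonempty sets.\<close>

lemma finite_nullities: "finite (nullity ` (S :: (real ^ 'n ^ 'm) set))"
proof (rule finite_subset)
  show "nullity ` S \<subseteq> {..CARD('n)}"
    using dim_subset_UNIV_cart by (auto simp: nullity_def)
qed simp

lemma probe_matrices_nonempty:
  assumes "simple_graph E"
  shows "probe_matrices E N \<noteq> {}"
proof -
  have "(\<chi> i j. if E i j then 1 else 0) \<in> graph_matrices E"
    using assms by (auto simp: graph_matrices_def transpose_def vec_eq_iff simple_graph_def symp_def)
  moreover have "E \<in> probe_completions E N"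
    using assms by (auto simp: probe_completions_def)
  ultimately show ?thesis
    by (auto simp: probe_matrices_def)
qed

lemma probe_zero_forcing_set_UNIV: "probe_zero_forcing_set E N UNIV"
  by (simp add: probe_zero_forcing_set_def)

end

theory Submission
  imports Defs
begin

text \<open>
  The nullity is at most the forcing number because a null vector that vanishes on a forcing set
  vanishes everywhere: a force \<open>v \<rightarrow> w\<close> says that in row \<open>v\<close> the only term not yet known to vanish is
  the one at \<open>w\<close>. Edges added between non-probe vertices do no harm, since a non-probe
  vertex forces only when all of \<open>N\<close> is blue (\<open>nullity_le_card_forcing_set\<close>).

  A probe forcing set of two vertices produces two forcing chains, and these are the two parallel
  paths. A vertex that has forced has no white neighbor left, so each newly
  forced vertex is attached only to the end of its own chain and perhaps to the end of the other one;
  such an edge crosses no earlier edge (\<open>forcing_chains_extend\<close>).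

  For a matrix of nullity two, the core is that a graph all of whose matrices have nullity at most
  one is a path (\<open>path_graph_if_nullity_le_1\<close>), a theorem of Fiedler. Ask for a matrix \<open>A\<close> that
  annihilates the constant vector and a vector \<open>t\<close>. The diagonal takes care of the constant vector,
  and what remains is that \<open>b i j = A i j * (t j - t i)\<close>, which is antisymmetric, has zero
  row sums. Thus \<open>b\<close> is a circulation, and conversely a circulation \<open>b\<close> together with a
  nonconstant \<open>t\<close> that differs across exactly the edges carrying \<open>b\<close> gives back \<open>A\<close>. If \<open>b\<close> has
  maximal support, no edge carrying \<open>b\<close> joins two vertices connected by edges not carrying \<open>b\<close>,
  for otherwise adding a multiple of the resulting cycle would enlarge the support; so \<open>t\<close> can
  label the components of the edges not carrying \<open>b\<close>. This \<open>t\<close> is constant only if the graph is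
  connected and has no nonzero circulation, that is, if it is a tree. A tree with a vertex of degree
  at least three has a matrix of nullity two as well (\<open>nullity_ge_2_if_three_branches\<close>), and a tree without
  such a vertex is a path.

  If every matrix of the probe graph had nullity at most one, then \<open>G\<close> would be a path. A path with at
  most one non-probe vertex is forced from one of its ends, so with forcing number two there are two
  non-probe vertices; joining them gives a completion with a cycle, which is not a tree.
\<close>

section \<open>Nullity is at most the forcing number\<close>

lemma kernel_vanishes_after_step:
  assumes A: "A \<in> probe_matrices E N" and ker: "A *v x = 0"
    and zero: "\<forall>i\<in>B. x $ i = 0" and step: "probe_step E N B B'"
  shows "\<forall>i\<in>B'. x $ i = 0"
proof -
  obtain H where H: "H \<in> probe_completions E N" and AH: "A \<in> graph_matrices H"
    using A by (auto simp: probe_matrices_def)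
  obtain v w where f: "probe_forces E N B v w" and B': "B' = insert w B"
    using step by (auto simp: probe_step_def)
  have white: "{x. E v x \<and> x \<notin> B} = {w}"
    and v: "v \<in> B \<and> v \<notin> N \<or> N \<subseteq> B \<and> v \<in> N"
    using f by (auto simp: probe_forces_def)
  have "E v w" "w \<notin> B" using white by auto
  have "v \<in> B" using v by auto
  have "v \<noteq> w" using \<open>v \<in> B\<close> \<open>w \<notin> B\<close> by auto
  \<comment> \<open>Row \<open>v\<close> has no other nonzero contribution: an edge of \<open>H\<close> at \<open>v\<close> outside \<open>E\<close> ends in \<open>N\<close>,
    and then \<open>v \<in> N\<close> was allowed to force only because \<open>N\<close> is blue.\<close>
  have other: "A $ v $ j * x $ j = 0" if "j \<noteq> w" for j
  proof (cases "j \<in> B")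
    case True
    then show ?thesis using zero by simp
  next
    case False
    then have "\<not> E v j" using white that by auto
    moreover have "\<not> (v \<in> N \<and> j \<in> N)" using v False by auto
    ultimately have "\<not> H v j" using H by (auto simp: probe_completions_def)
    moreover have "v \<noteq> j" using False \<open>v \<in> B\<close> by auto
    ultimately have "A $ v $ j = 0" using AH by (auto simp: graph_matrices_def)
    then show ?thesis by simp
  qed
  have "0 = (A *v x) $ v" using ker by simp
  also have "\<dots> = (\<Sum>j\<in>UNIV. A $ v $ j * x $ j)" by (simp add: matrix_vector_mult_def)
  also have "\<dots> = A $ v $ w * x $ w"
    using other by (subst sum.remove[of _ w]) (simp_all add: sum.neutral)
  finally have "A $ v $ w * x $ w = 0" by simp
  moreover have "A $ v $ w \<noteq> 0"
    using H AH \<open>E v w\<close> \<open>v \<noteq> w\<close> by (auto simp: graph_matrices_def probe_completions_def)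
  ultimately show ?thesis using zero B' by auto
qed

lemma kernel_vanishing_on_forcing_set:
  assumes A: "A \<in> probe_matrices E N" and ker: "A *v x = 0"
    and zero: "\<forall>i\<in>B. x $ i = 0" and B: "probe_zero_forcing_set E N B"
  shows "x = 0"
proof -
  have "\<forall>i\<in>C. x $ i = 0" if "(probe_step E N)\<^sup>*\<^sup>* B C" for C
    using that
  proof (induction rule: rtranclp_induct)
    case base
    then show ?case using zero by simp
  next
    case (step C D)
    then show ?case using kernel_vanishes_after_step[OF A ker] by blast
  qed
  then have "\<forall>i\<in>UNIV. x $ i = 0" using B unfolding probe_zero_forcing_set_def by blast
  then show ?thesis by (simp add: vec_eq_iff)
qed

text \<open>Restriction to \<open>B\<close> is injective on the kernel.\<close>

lemma nullity_le_card_forcing_set: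
  fixes A :: "real ^ 'v::finite ^ 'v"
  assumes A: "A \<in> probe_matrices E N" and B: "probe_zero_forcing_set E N B"
  shows "nullity A \<le> card B"
proof -
  define r :: "real ^ 'v \<Rightarrow> real ^ 'v" where "r x = (\<chi> i. if i \<in> B then x $ i else 0)" for x
  let ?K = "{x. A *v x = 0}"
  have lin: "linear r"
    by (rule linearI) (auto simp: r_def vec_eq_iff)
  have sub: "subspace ?K"
    by (auto simp: subspace_def matrix_vector_right_distrib matrix_vector_mult_scaleR)
  have inj: "inj_on r ?K"
  proof (rule inj_onI)
    fix x y assume x: "x \<in> ?K" and y: "y \<in> ?K" and eq: "r x = r y"
    have "A *v (x - y) = 0"
      using x y by (simp add: matrix_vector_mult_diff_distrib)
    moreover have "\<forall>i\<in>B. (x - y) $ i = 0"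
    proof
      fix i assume "i \<in> B"
      then show "(x - y) $ i = 0" using arg_cong[OF eq, of "\<lambda>z. z $ i"] by (simp add: r_def)
    qed
    ultimately have "x - y = 0" using kernel_vanishing_on_forcing_set[OF A _ _ B] by blast
    then show "x = y" by simp
  qed
  have "span ?K = ?K" using sub by (simp add: span_eq_iff)
  then have "dim ?K = dim (r ` ?K)"
    using dim_image_eq[OF lin, of ?K] inj by metis
  also have "\<dots> \<le> dim {x :: real ^ 'v. \<forall>i. i \<notin> B \<longrightarrow> x $ i = 0}"
    by (rule dim_subset) (auto simp: r_def)
  also have "\<dots> = card B" by (simp add: dim_substandard_cart flip: dim_vec_eq)
  finally show ?thesis by (simp add: nullity_def)
qed

section \<open>Two forcing chains are parallel paths\<close>

definition noncrossing :: "('v \<Rightarrow> 'v \<Rightarrow> bool) \<Rightarrow> 'v list \<Rightarrow> 'v list \<Rightarrow> bool" where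
  "noncrossing E vs us \<longleftrightarrow>
    (\<forall>i<length vs. \<forall>j<length us. E (vs ! i) (us ! j) \<longrightarrow>
           (\<forall>x<length vs. \<forall>y<length us.
              (x > i \<and> y < j) \<or> (x < i \<and> y > j) \<longrightarrow> \<not> E (vs ! x) (us ! y)))"

lemma noncrossing_sym:
  assumes "symp E" "noncrossing E vs us"
  shows "noncrossing E us vs"
proof -
  have sym: "E x y \<longleftrightarrow> E y x" for x y using assms(1) by (auto dest: sympD)
  have nc: "\<not> E (vs ! x) (us ! y)"
    if "i < length vs" "j < length us" "E (vs ! i) (us ! j)" "x < length vs" "y < length us"
      "x > i \<and> y < j \<or> x < i \<and> y > j" for i j x y
    using assms(2) that unfolding noncrossing_def by blast
  show ?thesis
    unfolding noncrossing_def
  proof (intro allI impI)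
    fix i j x y
    assume "i < length us" "j < length vs" "E (us ! i) (vs ! j)" "x < length us" "y < length vs"
      "x > i \<and> y < j \<or> x < i \<and> y > j"
    then have "\<not> E (vs ! y) (us ! x)"
      by (intro nc[of j i y x]) (simp_all add: sym[of "us ! i"] conj_commute disj_commute)
    then show "\<not> E (us ! x) (vs ! y)" by (simp add: sym)
  qed
qed

text \<open>Only the ends of the two chains can still have white neighbors; hence the next forced vertex
  extends one chain, and its only possible other blue neighbor is the end of the other chain.\<close>

definition forcing_chains :: "('v \<Rightarrow> 'v \<Rightarrow> bool) \<Rightarrow> 'v set \<Rightarrow> 'v list \<Rightarrow> 'v list \<Rightarrow> bool" where
  "forcing_chains E B vs us \<longleftrightarrow>
    induced_path E vs \<and> induced_path E us \<and> set vs \<inter> set us = {} \<and> set vs \<union> set us = B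
    \<and> noncrossing E vs us
    \<and> (\<forall>v\<in>B - {last vs, last us}. \<forall>x. E v x \<longrightarrow> x \<in> B)"

lemma forcing_chains_sym:
  assumes "symp E" "forcing_chains E B vs us"
  shows "forcing_chains E B us vs"
  using assms(2) noncrossing_sym[OF assms(1), of vs us]
  unfolding forcing_chains_def Int_commute[of "set us"] Un_commute[of "set us"]
    insert_commute[of "last us"]
  by (elim conjE) (intro conjI)

lemma induced_path_snoc:
  assumes E: "symp E" "irreflp E" and vs: "induced_path E vs" and w: "w \<notin> set vs"
    and only: "\<forall>v\<in>set vs. E v w \<longleftrightarrow> v = last vs"
  shows "induced_path E (vs @ [w])"
proof -
  have ne: "vs \<noteq> []" and dist: "distinct vs"
    and ind: "\<forall>i<length vs. \<forall>j<length vs. E (vs ! i) (vs ! j) \<longleftrightarrow> j = Suc i \<or> i = Suc j"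
    using vs by (auto simp: induced_path_def)
  have end_edge: "E (vs ! i) w \<longleftrightarrow> Suc i = length vs" if "i < length vs" for i
    using only that dist ne by (auto simp: last_conv_nth nth_eq_iff_index_eq)
  have sym: "E x y \<longleftrightarrow> E y x" for x y using E by (auto simp: symp_def)
  have "\<not> E w w" using E by (auto simp: irreflp_def)
  then have "E ((vs @ [w]) ! i) ((vs @ [w]) ! j) \<longleftrightarrow> j = Suc i \<or> i = Suc j"
    if "i \<le> length vs" "j \<le> length vs" for i j
    using that ind end_edge sym by (cases "i = length vs"; cases "j = length vs") (auto simp: nth_append)
  then show ?thesis using dist w by (auto simp: induced_path_def)
qed

lemma noncrossing_snoc:
  assumes nc: "noncrossing E vs us" and us: "distinct us"
    and only: "\<forall>u\<in>set us. E w u \<longrightarrow> u = last us"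
  shows "noncrossing E (vs @ [w]) us"
proof -
  have last: "Suc j = length us" if "E w (us ! j)" "j < length us" for j
    using only that us by (cases "us = []") (auto simp: last_conv_nth nth_eq_iff_index_eq)
  show ?thesis
    unfolding noncrossing_def
  proof (intro allI impI)
    fix i j x y
    assume i: "i < length (vs @ [w])" and j: "j < length us" and e: "E ((vs @ [w]) ! i) (us ! j)"
      and x: "x < length (vs @ [w])" and y: "y < length us" and c: "x > i \<and> y < j \<or> x < i \<and> y > j"
    show "\<not> E ((vs @ [w]) ! x) (us ! y)"
    proof (cases "i < length vs \<and> x < length vs")
      case True
      then have "E (vs ! i) (us ! j)" using e by (simp add: nth_append)
      then have "\<not> E (vs ! x) (us ! y)" using nc c j y True unfolding noncrossing_def by blast
      then show ?thesis using True by (simp add: nth_append)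
    next
      case False
      then have "x = length vs \<and> y < j \<or> i = length vs \<and> j < y" using i x c by auto
      then show ?thesis using e j y last[of j] last[of y] by auto
    qed
  qed
qed

lemma forcing_chains_extend:
  assumes E: "symp E" "irreflp E" and fc: "forcing_chains E B vs us"
    and white: "{x. E (last vs) x \<and> x \<notin> B} = {w}"
  shows "forcing_chains E (insert w B) (vs @ [w]) us"
proof -
  have w: "w \<notin> B" "E (last vs) w" using white by auto
  have vs: "induced_path E vs" and us: "induced_path E us" and disj: "set vs \<inter> set us = {}"
    and B: "set vs \<union> set us = B" and nc: "noncrossing E vs us"
    and full: "\<And>v x. v \<in> B \<Longrightarrow> v \<noteq> last vs \<Longrightarrow> v \<noteq> last us \<Longrightarrow> E v x \<Longrightarrow> x \<in> B"
    using fc unfolding forcing_chains_def by blast+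
  have "vs \<noteq> []" "us \<noteq> []" using vs us by (auto simp: induced_path_def)
  then have lasts: "last vs \<in> set vs" "last us \<in> set us" by auto
  have unmet: "v = last vs \<or> v = last us" if "v \<in> B" "E v w" for v
    using full that w(1) by blast
  have "\<forall>v\<in>set vs. E v w \<longleftrightarrow> v = last vs"
    using unmet w lasts disj B by blast
  then have "induced_path E (vs @ [w])" using induced_path_snoc[OF E vs] w B by auto
  moreover have "\<forall>u\<in>set us. E w u \<longrightarrow> u = last us"
    using unmet lasts disj B sympD[OF E(1)] by blast
  then have "noncrossing E (vs @ [w]) us"
    using noncrossing_snoc[OF nc] us by (auto simp: induced_path_def)
  moreover have "\<forall>v\<in>insert w B - {w, last us}. \<forall>x. E v x \<longrightarrow> x \<in> insert w B"
    using full white by blast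
  moreover have "w \<notin> set us" using B w(1) by blast
  ultimately show ?thesis
    using us disj B unfolding forcing_chains_def by simp
qed

lemma forcing_chains_step:
  assumes E: "symp E" "irreflp E" and fc: "forcing_chains E B vs us"
    and step: "probe_step E N B B'"
  shows "\<exists>vs us. forcing_chains E B' vs us"
proof -
  obtain v w where f: "probe_forces E N B v w" and B': "B' = insert w B"
    using step by (auto simp: probe_step_def)
  have white: "{x. E v x \<and> x \<notin> B} = {w}" and "v \<in> B"
    using f by (auto simp: probe_forces_def)
  then have "v = last vs \<or> v = last us"
    using fc unfolding forcing_chains_def by blast
  then show ?thesis
  proof
    assume "v = last vs"
    then show ?thesis using forcing_chains_extend[OF E fc] white B' by blast
  next
    assume "v = last us"
    then show ?thesis
      using forcing_chains_extend[OF E forcing_chains_sym[OF E(1) fc]] white B' by blast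
  qed
qed

theorem two_parallel_paths_if_forcing_pair:
  fixes E :: "'v::finite \<Rightarrow> 'v \<Rightarrow> bool"
  assumes E: "simple_graph E" and B: "probe_zero_forcing_set E N B" and card: "card B = 2"
  shows "two_parallel_paths E"
proof -
  have sE: "symp E" "irreflp E" using E unfolding simple_graph_def by blast+
  obtain a b where ab: "B = {a, b}" "a \<noteq> b" using card unfolding card_2_iff by blast
  have "induced_path E [x]" for x
    using sE(2) by (simp add: induced_path_def irreflp_def)
  then have "forcing_chains E B [a] [b]"
    using ab by (auto simp: forcing_chains_def noncrossing_def)
  then have start: "\<exists>vs us. forcing_chains E B vs us" by blast
  have "\<exists>vs us. forcing_chains E C vs us" if "(probe_step E N)\<^sup>*\<^sup>* B C" for C
    using that
  proof (induction rule: rtranclp_induct)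
    case base
    then show ?case using start .
  next
    case (step C D)
    then show ?case using forcing_chains_step[OF sE] by blast
  qed
  then obtain vs us where fc: "forcing_chains E UNIV vs us"
    using B unfolding probe_zero_forcing_set_def by blast
  then have paths: "induced_path E vs" "induced_path E us" and disj: "set vs \<inter> set us = {}"
    and cover: "set vs \<union> set us = UNIV" and nc: "noncrossing E vs us"
    unfolding forcing_chains_def by blast+
  have "distinct (vs @ us)" and "set (vs @ us) = UNIV"
    using paths disj cover by (simp_all add: induced_path_def)
  then have len: "length vs + length us = CARD('v)"
    using distinct_card[of "vs @ us"] by simp
  show ?thesis
    unfolding two_parallel_paths_def
    by (intro disjI1 exI[of _ vs] exI[of _ us] conjI paths disj len nc[unfolded noncrossing_def])
qed

section \<open>Matrices with a two-dimensional kernel\<close>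

text \<open>The diagonal is free, so only the off-diagonal part of each row has to be balanced: it must send
  \<open>(x, y)\<close> to a multiple of \<open>(x i, y i)\<close>.\<close>

lemma nullity_ge_2I:
  fixes E :: "'v::finite \<Rightarrow> 'v \<Rightarrow> bool" and a :: "'v \<Rightarrow> 'v \<Rightarrow> real"
  assumes sym: "\<And>i j. a i j = a j i" and supp: "\<And>i j. i \<noteq> j \<Longrightarrow> a i j \<noteq> 0 \<longleftrightarrow> E i j"
    and rows: "\<And>i. \<exists>d. d * x i + (\<Sum>j\<in>UNIV - {i}. a i j * x j) = 0
                       \<and> d * y i + (\<Sum>j\<in>UNIV - {i}. a i j * y j) = 0"
    and indep: "x p * y q \<noteq> x q * y p"
  shows "\<exists>A\<in>graph_matrices E. nullity A \<ge> 2"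
proof -
  obtain d where dx: "\<And>i. d i * x i + (\<Sum>j\<in>UNIV - {i}. a i j * x j) = 0"
    and dy: "\<And>i. d i * y i + (\<Sum>j\<in>UNIV - {i}. a i j * y j) = 0"
    using rows by metis
  define A :: "real ^ 'v ^ 'v" where "A = (\<chi> i j. if i = j then d i else a i j)"
  define X Y :: "real ^ 'v" where "X = (\<chi> i. x i)" and "Y = (\<chi> i. y i)"
  have ker: "A *v (\<chi> i. z i) = 0"
    if "\<And>i. d i * z i + (\<Sum>j\<in>UNIV - {i}. a i j * z j) = 0" for z
  proof -
    have "(\<Sum>j\<in>UNIV. (if i = j then d i else a i j) * z j) = 0" for i
    proof -
      have "(\<Sum>j\<in>UNIV. (if i = j then d i else a i j) * z j)
          = d i * z i + (\<Sum>j\<in>UNIV - {i}. (if i = j then d i else a i j) * z j)"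
        by (subst sum.remove[of _ i]) auto
      also have "(\<Sum>j\<in>UNIV - {i}. (if i = j then d i else a i j) * z j)
          = (\<Sum>j\<in>UNIV - {i}. a i j * z j)"
        by (rule sum.cong) auto
      finally show ?thesis using that by simp
    qed
    then show ?thesis by (simp add: A_def matrix_vector_mult_def vec_eq_iff)
  qed
  have "A \<in> graph_matrices E"
    using sym supp by (auto simp: A_def graph_matrices_def transpose_def vec_eq_iff)
  moreover have "nullity A \<ge> 2"
  proof -
    have not_mult: "X \<noteq> k *\<^sub>R Y" for k
    proof
      assume "X = k *\<^sub>R Y"
      then have "x i = k * y i" for i by (simp add: X_def Y_def vec_eq_iff)
      then show False using indep by simp
    qed
    have "Y \<noteq> 0"
    proof
      assume "Y = 0"
      then have "y i = 0" for i by (simp add: Y_def vec_eq_iff)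
      then show False using indep by simp
    qed
    then have "independent {X, Y}"
      using not_mult by (auto simp: independent_insert span_singleton)
    moreover have "{X, Y} \<subseteq> {x. A *v x = 0}"
      using ker dx dy by (auto simp: X_def Y_def)
    ultimately have "card {X, Y} \<le> nullity A"
      unfolding nullity_def by (intro independent_card_le_dim)
    moreover have "X \<noteq> Y" using not_mult[of 1] by simp
    ultimately show ?thesis by simp
  qed
  ultimately show ?thesis by blast
qed

section \<open>Circulations\<close>

definition flow_on :: "('v \<Rightarrow> 'v \<Rightarrow> bool) \<Rightarrow> ('v \<Rightarrow> 'v \<Rightarrow> real) \<Rightarrow> bool" where
  "flow_on E f \<longleftrightarrow> (\<forall>x y. f x y = - f y x) \<and> (\<forall>x y. f x y \<noteq> 0 \<longrightarrow> E x y)"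

lemma flow_onI:
  assumes "\<And>x y. f x y = - f y x" "\<And>x y. f x y \<noteq> 0 \<Longrightarrow> E x y"
  shows "flow_on E f"
  unfolding flow_on_def by (intro conjI allI impI assms)

lemma flow_on_antisym:
  assumes "flow_on E f"
  shows "f x y = - f y x"
  by (rule assms[unfolded flow_on_def, THEN conjunct1, rule_format])

lemma flow_on_edge:
  assumes "flow_on E f" "f x y \<noteq> 0"
  shows "E x y"
  by (rule assms(1)[unfolded flow_on_def, THEN conjunct2, rule_format, OF assms(2)])

definition circulation :: "('v::finite \<Rightarrow> 'v \<Rightarrow> bool) \<Rightarrow> ('v \<Rightarrow> 'v \<Rightarrow> real) \<Rightarrow> bool" where
  "circulation E f \<longleftrightarrow> flow_on E f \<and> (\<forall>x. (\<Sum>y\<in>UNIV. f x y) = 0)"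

lemma circulation_antisym: "circulation E f \<Longrightarrow> f x y = - f y x"
  unfolding circulation_def by (elim conjE) (rule flow_on_antisym)

lemma circulation_edge: "circulation E f \<Longrightarrow> f x y \<noteq> 0 \<Longrightarrow> E x y"
  unfolding circulation_def by (elim conjE) (rule flow_on_edge)

lemma circulation_eq_0_commute: "circulation E f \<Longrightarrow> f x y = 0 \<longleftrightarrow> f y x = 0"
  by (subst circulation_antisym[of E f x y]) simp_all

lemma circulation_zero: "circulation E (\<lambda>x y. 0)"
  by (simp add: circulation_def flow_on_def)

definition unit_flow :: "'v \<Rightarrow> 'v \<Rightarrow> 'v \<Rightarrow> 'v \<Rightarrow> real" where
  "unit_flow u v x y = of_bool (x = u \<and> y = v) - of_bool (x = v \<and> y = u)"

lemma sum_unit_flow: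
  "(\<Sum>y\<in>UNIV. unit_flow u v x (y::'v::finite)) = of_bool (x = u) - of_bool (x = v)"
proof -
  have "(\<Sum>y\<in>UNIV. of_bool (x = a \<and> y = b)) = (of_bool (x = a) :: real)" for a b :: 'v
    by (cases "x = a") (simp_all add: of_bool_def)
  then show ?thesis by (simp add: unit_flow_def sum_subtractf)
qed

lemma flow_on_unit_flow:
  assumes "E u v" "symp E"
  shows "flow_on E (unit_flow u v)"
proof (rule flow_onI)
  show "unit_flow u v x y = - unit_flow u v y x" for x y
    by (simp add: unit_flow_def conj_commute)
  show "E x y" if "unit_flow u v x y \<noteq> 0" for x y
  proof -
    have "x = u \<and> y = v \<or> x = v \<and> y = u" using that by (auto simp: unit_flow_def)
    then show ?thesis using assms by (auto dest: sympD)
  qed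
qed

lemma flow_on_add:
  assumes "flow_on E f" "flow_on E g"
  shows "flow_on E (\<lambda>x y. f x y + c * g x y)"
proof -
  have "f x y + c * g x y = - (f y x + c * g y x)" for x y
    by (subst flow_on_antisym[OF assms(1), of x y], subst flow_on_antisym[OF assms(2), of x y]) simp
  moreover have "E x y" if "f x y + c * g x y \<noteq> 0" for x y
  proof -
    have "f x y \<noteq> 0 \<or> g x y \<noteq> 0" using that by auto
    then show ?thesis using flow_on_edge assms by metis
  qed
  ultimately show ?thesis by (rule flow_onI)
qed

lemma flow_on_mono:
  assumes "flow_on E f" "\<And>x y. E x y \<Longrightarrow> F x y"
  shows "flow_on F f"
proof (rule flow_onI)
  show "f x y = - f y x" for x y using assms(1) by (rule flow_on_antisym)
  show "F x y" if "f x y \<noteq> 0" for x y using assms(2)[OF flow_on_edge[OF assms(1) that]] .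
qed

lemma path_flow:
  fixes R :: "'v::finite \<Rightarrow> 'v \<Rightarrow> bool"
  assumes "symp R" "R\<^sup>*\<^sup>* u v"
  shows "\<exists>f. flow_on R f \<and> (\<forall>x. (\<Sum>y\<in>UNIV. f x y) = of_bool (x = u) - of_bool (x = v))"
  using assms(2)
proof (induction rule: rtranclp_induct)
  case base
  have "flow_on R (\<lambda>x y. 0)" by (auto simp: flow_on_def)
  then show ?case by (intro exI[of _ "\<lambda>x y. 0"]) simp
next
  case (step v w)
  then obtain f where f: "flow_on R f"
    and div: "\<forall>x. (\<Sum>y\<in>UNIV. f x y) = of_bool (x = u) - of_bool (x = v)" by blast
  have "flow_on R (\<lambda>x y. f x y + 1 * unit_flow v w x y)"
    using f flow_on_unit_flow[of R v w] assms(1) step by (intro flow_on_add) auto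
  moreover have "\<forall>x. (\<Sum>y\<in>UNIV. f x y + 1 * unit_flow v w x y) = of_bool (x = u) - of_bool (x = w)"
    using div by (simp add: sum.distrib sum_unit_flow)
  ultimately show ?case by blast
qed

definition delete_edge :: "('v \<Rightarrow> 'v \<Rightarrow> bool) \<Rightarrow> 'v \<Rightarrow> 'v \<Rightarrow> 'v \<Rightarrow> 'v \<Rightarrow> bool" where
  "delete_edge E u v x y \<longleftrightarrow> E x y \<and> {x, y} \<noteq> {u, v}"

lemma symp_delete_edge: "symp E \<Longrightarrow> symp (delete_edge E u v)"
  by (rule sympI) (auto simp: delete_edge_def doubleton_eq_iff dest: sympD)

text \<open>Closing a flow from \<open>u\<close> to \<open>v\<close> by the edge back gives a circulation.\<close>

lemma cycle_circulation:
  fixes E :: "'v::finite \<Rightarrow> 'v \<Rightarrow> bool"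
  assumes E: "symp E" "E u v" "u \<noteq> v" and R: "symp R" "R\<^sup>*\<^sup>* u v"
    and sub: "\<And>x y. R x y \<Longrightarrow> delete_edge E u v x y"
  shows "\<exists>c. circulation E c \<and> c u v = - 1 \<and> (\<exists>x y. R x y \<and> c x y \<noteq> 0)"
proof -
  obtain f where f: "flow_on R f"
    and div: "\<And>x. (\<Sum>y\<in>UNIV. f x y) = of_bool (x = u) - of_bool (x = v)"
    using path_flow[OF R] by blast
  define c where "c x y = f x y + (- 1) * unit_flow u v x y" for x y
  have "flow_on E f"
    using f by (rule flow_on_mono) (auto dest: sub simp: delete_edge_def)
  then have "flow_on E c"
    unfolding c_def using flow_on_unit_flow[of E u v] E by (intro flow_on_add) auto
  moreover have "(\<Sum>y\<in>UNIV. c x y) = 0" for x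
    unfolding c_def using div[of x] by (simp add: sum_subtractf sum_unit_flow)
  ultimately have "circulation E c" by (simp add: circulation_def)
  moreover have "f u v = 0"
    using flow_on_edge[OF f] sub by (auto simp: delete_edge_def)
  then have "c u v = - 1"
    using E by (simp add: c_def unit_flow_def)
  moreover have "\<exists>x y. R x y \<and> c x y \<noteq> 0"
  proof -
    have "(\<Sum>y\<in>UNIV. f u y) \<noteq> 0" using div[of u] E by simp
    then obtain y where y: "f u y \<noteq> 0" by (meson sum.neutral)
    then have "R u y" by (rule flow_on_edge[OF f])
    moreover have "y \<noteq> v" using y \<open>f u v = 0\<close> by auto
    then have "c u y = f u y" using E by (simp add: c_def unit_flow_def)
    ultimately show ?thesis using y by (intro exI[of _ u] exI[of _ y]) simp
  qed
  ultimately show ?thesis by blast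
qed

definition support :: "('v \<Rightarrow> 'v \<Rightarrow> real) \<Rightarrow> ('v \<times> 'v) set" where
  "support b = {(x, y). b x y \<noteq> 0}"

lemma ex_circulation_of_maximal_support:
  fixes E :: "'v::finite \<Rightarrow> 'v \<Rightarrow> bool"
  obtains b where "circulation E b"
    and "\<And>c. circulation E c \<Longrightarrow> card (support c) \<le> card (support b)"
proof -
  have "card (support c) < Suc CARD('v \<times> 'v)" for c :: "'v \<Rightarrow> 'v \<Rightarrow> real"
    using card_mono[of UNIV "support c"] by simp
  then have "\<exists>b. circulation E b \<and> (\<forall>c. circulation E c \<longrightarrow> card (support c) \<le> card (support b))"
    by (intro ex_has_greatest_nat[where P = "circulation E" and k = "\<lambda>x y. 0"
          and b = "Suc CARD('v \<times> 'v)"] circulation_zero allI impI)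
  then show thesis using that by (elim exE conjE) (simp only: mp)
qed

text \<open>An edge carrying \<open>b\<close> and a path of edges not carrying \<open>b\<close> would close up to a circulation \<open>c\<close>,
  and a generic combination of \<open>b\<close> and \<open>c\<close> has larger support than \<open>b\<close>.\<close>

lemma maximal_support_separates:
  fixes E :: "'v::finite \<Rightarrow> 'v \<Rightarrow> bool"
  assumes E: "symp E" "irreflp E" and b: "circulation E b"
    and max: "\<And>c. circulation E c \<Longrightarrow> card (support c) \<le> card (support b)"
    and buv: "b u v \<noteq> 0"
  shows "\<not> (\<lambda>x y. E x y \<and> b x y = 0)\<^sup>*\<^sup>* u v"
proof
  let ?R = "\<lambda>x y. E x y \<and> b x y = 0"
  assume con: "?R\<^sup>*\<^sup>* u v"
  have b0: "b x y = 0 \<longleftrightarrow> b y x = 0" for x y using circulation_eq_0_commute[OF b] .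
  have uv: "E u v" using circulation_edge[OF b buv] .
  have "u \<noteq> v" using uv E(2) by (auto simp: irreflp_def)
  have symR: "symp ?R" using sympD[OF E(1)] b0 by (intro sympI) blast
  have del: "delete_edge E u v x y" if "?R x y" for x y
    using that buv b0[of u v] by (auto simp: delete_edge_def doubleton_eq_iff)
  obtain c p q where c: "circulation E c" "c u v = - 1"
    and pq: "?R p q" "c p q \<noteq> 0"
    using cycle_circulation[OF E(1) uv \<open>u \<noteq> v\<close> symR con del] by blast
  \<comment> \<open>Only finitely many multiples of \<open>c\<close> cancel a nonzero value of \<open>b\<close>.\<close>
  obtain e where e: "e \<noteq> 0" "\<And>x y. b x y \<noteq> 0 \<Longrightarrow> b x y + e * c x y \<noteq> 0"
  proof -
    have "finite (insert 0 (range (\<lambda>(x, y). - b x y / c x y)))" by simp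
    then obtain e where e: "e \<notin> insert 0 (range (\<lambda>(x, y). - b x y / c x y))"
      using ex_new_if_finite[OF infinite_UNIV_char_0] by blast
    have "b x y + e * c x y \<noteq> 0" if "b x y \<noteq> 0" for x y
    proof
      assume 0: "b x y + e * c x y = 0"
      then have "c x y \<noteq> 0" using that by auto
      then have "e = - b x y / c x y" using 0 by (simp add: field_simps)
      then have "e = (\<lambda>(x, y). - b x y / c x y) (x, y)" by simp
      then show False using e by blast
    qed
    then show thesis using that e by blast
  qed
  let ?g = "\<lambda>x y. b x y + e * c x y"
  have "circulation E ?g"
    using b c(1) flow_on_add[of E b c e] unfolding circulation_def
    by (simp add: sum.distrib flip: sum_distrib_left)
  then have "card (support ?g) \<le> card (support b)" by (rule max)
  moreover have "support b \<subset> support ?g"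
  proof
    show "support b \<subseteq> support ?g" using e(2) by (auto simp: support_def)
    have "(p, q) \<in> support ?g" "(p, q) \<notin> support b" using pq e(1) by (auto simp: support_def)
    then show "support b \<noteq> support ?g" by blast
  qed
  then have "card (support b) < card (support ?g)" by (intro psubset_card_mono) auto
  ultimately show False by simp
qed

section \<open>Graphs without a matrix of nullity two are paths\<close>

text \<open>Dividing the circulation by the differences of \<open>t\<close> makes it symmetric, and the resulting weighted
  Laplacian annihilates both the constant vector and \<open>t\<close>.\<close>

lemma nullity_ge_2_if_circulation_separates:
  fixes E :: "'v::finite \<Rightarrow> 'v \<Rightarrow> bool" and t :: "'v \<Rightarrow> real"
  assumes E: "symp E" and b: "circulation E b"
    and flat: "\<And>x y. E x y \<Longrightarrow> b x y = 0 \<Longrightarrow> t x = t y"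
    and steep: "\<And>x y. b x y \<noteq> 0 \<Longrightarrow> t x \<noteq> t y"
    and t: "t p \<noteq> t q"
  shows "\<exists>A\<in>graph_matrices E. nullity A \<ge> 2"
proof -
  note anti = circulation_antisym[OF b] and supp = circulation_edge[OF b]
  define a where "a i j = (if b i j \<noteq> 0 then b i j / (t j - t i) else of_bool (E i j))" for i j
  have drop: "a i j * (t j - t i) = b i j" for i j
  proof (cases "b i j = 0")
    case True
    then show ?thesis using flat[of i j] by (cases "E i j") (simp_all add: a_def)
  next
    case False
    then show ?thesis using steep[of i j] by (simp add: a_def)
  qed
  show ?thesis
  proof (rule nullity_ge_2I[where a = a and x = "\<lambda>_. 1" and y = t and p = p and q = q])
    show "a i j = a j i" for i j
    proof (cases "b i j = 0")
      case True
      then have "b j i = 0" using circulation_eq_0_commute[OF b, of i j] by simp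
      then show ?thesis using True sympD[OF E] by (auto simp: a_def of_bool_def)
    next
      case False
      moreover have "b j i \<noteq> 0" using False circulation_eq_0_commute[OF b, of i j] by simp
      moreover have "b j i / (t i - t j) = (- b j i) / (t j - t i)"
        by (metis minus_diff_eq minus_divide_divide)
      ultimately show ?thesis using anti[of i j] by (simp add: a_def)
    qed
    show "a i j \<noteq> 0 \<longleftrightarrow> E i j" for i j
      using steep[of i j] supp[of i j] by (auto simp: a_def)
    show "\<exists>d. d * 1 + (\<Sum>j\<in>UNIV - {i}. a i j * 1) = 0
            \<and> d * t i + (\<Sum>j\<in>UNIV - {i}. a i j * t j) = 0" for i
    proof (intro exI conjI)
      let ?d = "- (\<Sum>j\<in>UNIV - {i}. a i j)"
      show "?d * 1 + (\<Sum>j\<in>UNIV - {i}. a i j * 1) = 0" by simp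
      have "b i i = 0" using anti[of i i] by simp
      have "?d * t i + (\<Sum>j\<in>UNIV - {i}. a i j * t j) = (\<Sum>j\<in>UNIV - {i}. a i j * (t j - t i))"
        by (simp add: sum_distrib_right sum_subtractf right_diff_distrib)
      also have "\<dots> = (\<Sum>j\<in>UNIV - {i}. b i j)" by (simp add: drop)
      also have "\<dots> = (\<Sum>j\<in>UNIV. b i j)"
        using \<open>b i i = 0\<close> by (subst sum.remove[of UNIV i]) auto
      also have "\<dots> = 0" using b by (simp add: circulation_def)
      finally show "?d * t i + (\<Sum>j\<in>UNIV - {i}. a i j * t j) = 0" .
    qed
    show "1 * t q \<noteq> 1 * t p" using t by simp
  qed
qed

lemma ex_component_labelling:
  fixes R :: "'v::finite \<Rightarrow> 'v \<Rightarrow> bool"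
  assumes "symp R"
  shows "\<exists>t :: 'v \<Rightarrow> real. \<forall>x y. t x = t y \<longleftrightarrow> R\<^sup>*\<^sup>* x y"
proof -
  have sym: "R\<^sup>*\<^sup>* x y \<Longrightarrow> R\<^sup>*\<^sup>* y x" for x y
    using assms by (metis sympD symp_rtranclp)
  obtain f :: "'v set \<Rightarrow> nat" where f: "inj f"
    using finite_imp_inj_to_nat_seg[of "UNIV :: 'v set set"] by auto
  define t where "t x = real (f {y. R\<^sup>*\<^sup>* x y})" for x
  have "t x = t y \<longleftrightarrow> R\<^sup>*\<^sup>* x y" for x y
  proof -
    have "t x = t y \<longleftrightarrow> {z. R\<^sup>*\<^sup>* x z} = {z. R\<^sup>*\<^sup>* y z}"
      using f by (auto simp: t_def inj_eq)
    also have "\<dots> \<longleftrightarrow> R\<^sup>*\<^sup>* x y"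
      using sym by (auto intro: rtranclp_trans)
    finally show ?thesis .
  qed
  then show ?thesis by blast
qed

text \<open>The labelling \<open>t\<close> of the components of the edges not carrying a circulation \<open>b\<close> of maximal support
  must be constant, so these edges connect everything and \<open>b\<close>, being nonzero only across different
  components, is zero. A cycle would carry a circulation with larger support.\<close>

lemma tree_if_nullity_le_1:
  fixes E :: "'v::finite \<Rightarrow> 'v \<Rightarrow> bool"
  assumes E: "simple_graph E" and small: "\<forall>A\<in>graph_matrices E. nullity A < 2"
  shows connected_if_nullity_le_1: "E\<^sup>*\<^sup>* u v"
    and bridge_if_nullity_le_1: "E u v \<Longrightarrow> \<not> (delete_edge E u v)\<^sup>*\<^sup>* u v"
proof -
  have sE: "symp E" "irreflp E" using E unfolding simple_graph_def by blast+
  obtain b where b: "circulation E b"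
    and max: "\<And>c. circulation E c \<Longrightarrow> card (support c) \<le> card (support b)"
    using ex_circulation_of_maximal_support[where E = E] by blast
  let ?R = "\<lambda>x y. E x y \<and> b x y = 0"
  have "symp ?R"
    using sympD[OF sE(1)] circulation_eq_0_commute[OF b] by (intro sympI) blast
  then obtain t :: "'v \<Rightarrow> real" where t: "\<And>x y. t x = t y \<longleftrightarrow> ?R\<^sup>*\<^sup>* x y"
    using ex_component_labelling by blast
  have sep: "t x \<noteq> t y" if "b x y \<noteq> 0" for x y
    using maximal_support_separates[OF sE b max that] t by blast
  have const: "t p = t q" for p q
  proof (rule ccontr)
    assume "t p \<noteq> t q"
    moreover have "t x = t y" if "E x y" "b x y = 0" for x y
      using that t by blast
    ultimately have "\<exists>A\<in>graph_matrices E. nullity A \<ge> 2"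
      using sep by (intro nullity_ge_2_if_circulation_separates[OF sE(1) b]) auto
    then show False using small by fastforce
  qed
  then have zero: "b x y = 0" for x y using sep by blast
  have "?R\<^sup>*\<^sup>* u v" using const t by blast
  then show "E\<^sup>*\<^sup>* u v" using zero by simp
  show "\<not> (delete_edge E u v)\<^sup>*\<^sup>* u v" if uv: "E u v"
  proof
    assume con: "(delete_edge E u v)\<^sup>*\<^sup>* u v"
    have "u \<noteq> v" using uv sE by (auto simp: irreflp_def)
    then obtain c where c: "circulation E c" "c u v = - 1"
      using cycle_circulation[OF sE(1) uv _ symp_delete_edge[OF sE(1)] con] by blast
    have "support c \<noteq> {}" using c(2) by (force simp: support_def)
    then have "card (support c) > 0" by (simp add: card_gt_0_iff)
    moreover have "support b = {}" using zero by (simp add: support_def)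
    ultimately show False using max[OF c(1)] by simp
  qed
qed

text \<open>Since every edge at \<open>v\<close> is a bridge, each component of the graph without \<open>v\<close> contains at most one
  neighbor of \<open>v\<close>. The vectors \<open>z q1\<close> and \<open>z q2\<close> below, which are \<open>1\<close> on the branch of \<open>q1\<close>,
  respectively \<open>q2\<close>, and \<open>-1\<close> on the branch of \<open>q3\<close>, are constant on these components, so the Laplacian of
  the graph without \<open>v\<close> annihilates them; row \<open>v\<close> sums them over the neighbors of \<open>v\<close>, which gives
  \<open>1 - 1\<close>.\<close>

lemma nullity_ge_2_if_three_branches:
  fixes E :: "'v::finite \<Rightarrow> 'v \<Rightarrow> bool"
  assumes E: "simple_graph E"
    and bridge: "\<And>w. E v w \<Longrightarrow> \<not> (delete_edge E v w)\<^sup>*\<^sup>* v w"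
    and nb: "E v q1" "E v q2" "E v q3" and ne: "q1 \<noteq> q2" "q1 \<noteq> q3" "q2 \<noteq> q3"
  shows "\<exists>A\<in>graph_matrices E. nullity A \<ge> 2"
proof -
  have sE: "symp E" "irreflp E" using E unfolding simple_graph_def by blast+
  let ?S = "\<lambda>x y. E x y \<and> x \<noteq> v \<and> y \<noteq> v"
  define C where "C q = {w. ?S\<^sup>*\<^sup>* q w}" for q
  have one: "q = q'" if "E v q" "E v q'" "q' \<in> C q" for q q'
  proof (rule ccontr)
    assume "q \<noteq> q'"
    have "?S\<^sup>*\<^sup>* q q'" using that by (simp add: C_def)
    then have "(delete_edge E v q')\<^sup>*\<^sup>* q q'"
      by (rule rtranclp_mono[THEN predicate2D, rotated]) (auto simp: delete_edge_def doubleton_eq_iff)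
    moreover have "delete_edge E v q' v q"
      using that \<open>q \<noteq> q'\<close> by (auto simp: delete_edge_def doubleton_eq_iff)
    ultimately show False
      using bridge[OF that(2)] by (meson converse_rtranclp_into_rtranclp)
  qed
  have nb_ne: "q \<noteq> v" if "E v q" for q using that sE by (auto simp: irreflp_def)
  have vC: "v \<notin> C q" if "E v q" for q
  proof
    assume "v \<in> C q"
    then have "?S\<^sup>*\<^sup>* q v" by (simp add: C_def)
    then show False using nb_ne[OF that] by (cases rule: rtranclp.cases) auto
  qed
  have cong: "j \<in> C q \<longleftrightarrow> i \<in> C q" if "E i j" "i \<noteq> v" "j \<noteq> v" for i j q
    using that sE(1) unfolding C_def
    by (auto simp: symp_def intro: rtranclp.rtrancl_into_rtrancl)
  have count: "(\<Sum>j\<in>UNIV - {v}. of_bool (E v j) * of_bool (j \<in> C q)) = (1::real)" if "E v q" for q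
  proof -
    have "(\<Sum>j\<in>UNIV - {v}. of_bool (E v j) * of_bool (j \<in> C q)) = (\<Sum>j\<in>UNIV - {v}. of_bool (j = q) :: real)"
    proof (rule sum.cong)
      fix j
      have "q \<in> C q" by (simp add: C_def)
      then show "of_bool (E v j) * of_bool (j \<in> C q) = (of_bool (j = q) :: real)"
        using one[OF that, of j] that by (auto simp: of_bool_def)
    qed simp
    also have "\<dots> = 1" using nb_ne[OF that] by (simp add: of_bool_def)
    finally show ?thesis .
  qed
  define z where "z q i = (of_bool (i \<in> C q) - of_bool (i \<in> C q3) :: real)" for q i
  have zv: "z q v = 0" if "E v q" for q using vC that nb by (simp add: z_def)
  have row: "- (\<Sum>j\<in>UNIV - {i}. of_bool (E i j \<and> i \<noteq> v \<and> j \<noteq> v)) * z q i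
      + (\<Sum>j\<in>UNIV - {i}. of_bool (E i j) * z q j) = 0" if "E v q" for i q
  proof (cases "i = v")
    case True
    have "(\<Sum>j\<in>UNIV - {v}. of_bool (E v j) * z q j) = 0"
      using count[OF that] count[OF nb(3)] by (simp add: z_def right_diff_distrib sum_subtractf)
    then show ?thesis using True by simp
  next
    case False
    have "of_bool (E i j) * z q j = of_bool (E i j \<and> i \<noteq> v \<and> j \<noteq> v) * z q i" for j
      using False zv[OF that] cong[of i j] by (cases "j = v") (auto simp: of_bool_def z_def)
    then show ?thesis by (simp add: sum_distrib_right)
  qed
  show ?thesis
  proof (rule nullity_ge_2I[where a = "\<lambda>i j. of_bool (E i j)" and x = "z q1" and y = "z q2"
        and p = q1 and q = q2])
    show "of_bool (E i j) = (of_bool (E j i) :: real)" for i j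
      using sE(1) by (auto simp: symp_def of_bool_def)
    show "(of_bool (E i j) :: real) \<noteq> 0 \<longleftrightarrow> E i j" for i j by simp
    show "\<exists>d. d * z q1 i + (\<Sum>j\<in>UNIV - {i}. of_bool (E i j) * z q1 j) = 0
            \<and> d * z q2 i + (\<Sum>j\<in>UNIV - {i}. of_bool (E i j) * z q2 j) = 0" for i
      using row[OF nb(1)] row[OF nb(2)] by blast
    have self: "q \<in> C q" for q by (simp add: C_def)
    have "q1 \<notin> C q2" "q1 \<notin> C q3" "q2 \<notin> C q1" "q2 \<notin> C q3"
      using one nb ne by blast+
    then show "z q1 q1 * z q2 q2 \<noteq> z q1 q2 * z q2 q1"
      using self by (simp add: z_def)
  qed
qed

lemma exit_edge:
  assumes "E\<^sup>*\<^sup>* u v" "u \<in> S" "v \<notin> S"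
  shows "\<exists>x y. x \<in> S \<and> y \<notin> S \<and> E x y"
  using assms by (induction rule: rtranclp_induct) auto

text \<open>A longest path covers the tree: an edge leaving it at one of its ends would extend it, and an edge
  leaving it elsewhere would give a vertex with three branches. A chord would lie on a cycle.\<close>

theorem path_graph_if_nullity_le_1:
  fixes E :: "'v::finite \<Rightarrow> 'v \<Rightarrow> bool"
  assumes E: "simple_graph E" and small: "\<forall>A\<in>graph_matrices E. nullity A < 2"
  shows "path_graph E"
proof -
  have sE: "symp E" "irreflp E" using E unfolding simple_graph_def by blast+
  define walk where "walk vs \<longleftrightarrow> vs \<noteq> [] \<and> distinct vs
    \<and> (\<forall>i. Suc i < length vs \<longrightarrow> E (vs ! i) (vs ! Suc i))" for vs
  have "walk [undefined]" by (simp add: walk_def)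
  moreover have "\<forall>vs. walk vs \<longrightarrow> length vs < Suc CARD('v)"
    by (metis card_mono distinct_card finite less_Suc_eq_le top_greatest walk_def)
  ultimately obtain vs where vs: "walk vs" and max: "\<And>us. walk us \<Longrightarrow> length us \<le> length vs"
    using ex_has_greatest_nat[of walk "[undefined]" length] by blast
  have ne: "vs \<noteq> []" and dist: "distinct vs"
    and edge: "\<And>i. Suc i < length vs \<Longrightarrow> E (vs ! i) (vs ! Suc i)"
    using vs by (auto simp: walk_def)
  have all: "set vs = UNIV"
  proof (rule ccontr)
    assume "set vs \<noteq> UNIV"
    then obtain w where "w \<notin> set vs" by auto
    then obtain x y where xy: "x \<in> set vs" "y \<notin> set vs" "E x y"
      using exit_edge[OF connected_if_nullity_le_1[OF E small, of "hd vs" w], of "set vs"] ne by auto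
    then obtain i where i: "i < length vs" "x = vs ! i" by (metis in_set_conv_nth)
    have "i \<noteq> 0"
    proof
      assume "i = 0"
      then have "walk (y # vs)"
        using xy i dist edge ne sE(1) by (auto simp: walk_def nth_Cons symp_def split: nat.split)
      then show False using max by fastforce
    qed
    moreover have "Suc i \<noteq> length vs"
    proof
      assume "Suc i = length vs"
      then have "E (vs ! i') y" if "Suc i' = length vs" for i' using that xy i \<open>Suc i = length vs\<close> by (metis Suc_inject)
      then have "walk (vs @ [y])"
        using xy dist edge by (auto simp: walk_def nth_append less_Suc_eq)
      then show False using max by fastforce
    qed
    ultimately obtain k where k: "i = Suc k" "Suc i < length vs"
      using i by (metis Suc_lessI not0_implies_Suc)
    have "E x (vs ! k)" "E x (vs ! Suc i)"
      using edge[of k] edge[of i] k i sE(1) by (auto simp: symp_def)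
    moreover have "vs ! k \<noteq> vs ! Suc i" using dist k by (simp add: nth_eq_iff_index_eq)
    moreover have "vs ! k \<noteq> y" "vs ! Suc i \<noteq> y" using xy k i by auto
    ultimately have "\<exists>A\<in>graph_matrices E. nullity A \<ge> 2"
      using nullity_ge_2_if_three_branches[OF E bridge_if_nullity_le_1[OF E small], of x "vs ! k" "vs ! Suc i" y] xy
      by blast
    then show False using small by fastforce
  qed
  have forward: "j = Suc i" if "E (vs ! i) (vs ! j)" "i < j" "j < length vs" for i j
  proof (rule ccontr)
    assume "j \<noteq> Suc i"
    then have j: "Suc i < j" using that by simp
    have "(delete_edge E (vs ! i) (vs ! j))\<^sup>*\<^sup>* (vs ! i) (vs ! (i + k))" if "i + k \<le> j" for k
      using that
    proof (induction k)
      case (Suc k)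
      have "delete_edge E (vs ! i) (vs ! j) (vs ! (i + k)) (vs ! (i + Suc k))"
        using Suc.prems j \<open>j < length vs\<close> dist edge[of "i + k"]
        by (auto simp: delete_edge_def doubleton_eq_iff nth_eq_iff_index_eq)
      then show ?case using Suc by simp
    qed simp
    from this[of "j - i"] show False
      using bridge_if_nullity_le_1[OF E small that(1)] that by simp
  qed
  have "E (vs ! i) (vs ! j) \<longleftrightarrow> j = Suc i \<or> i = Suc j" if "i < length vs" "j < length vs" for i j
  proof
    assume e: "E (vs ! i) (vs ! j)"
    then have "E (vs ! j) (vs ! i)" "i \<noteq> j" using sE by (auto simp: symp_def irreflp_def)
    then show "j = Suc i \<or> i = Suc j"
      using forward[of i j] forward[of j i] e that by linarith
  next
    assume "j = Suc i \<or> i = Suc j"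
    then show "E (vs ! i) (vs ! j)" using edge that sE(1) by (auto simp: symp_def)
  qed
  then have "induced_path E vs" using ne dist by (simp add: induced_path_def)
  then show ?thesis using all by (auto simp: path_graph_def)
qed

section \<open>Probe graphs with forcing number two\<close>

text \<open>With at most one non-probe vertex the restriction on non-probe forces is void: such a vertex, once
  blue, is all of \<open>N\<close>.\<close>

lemma path_end_forces:
  fixes E :: "'v::finite \<Rightarrow> 'v \<Rightarrow> bool"
  assumes vs: "induced_path E vs" "set vs = UNIV" and N: "card N \<le> 1"
  shows "probe_zero_forcing_set E N {hd vs}"
proof -
  have ne: "vs \<noteq> []" and dist: "distinct vs"
    and ind: "\<And>i j. i < length vs \<Longrightarrow> j < length vs \<Longrightarrow> E (vs ! i) (vs ! j) \<longleftrightarrow> j = Suc i \<or> i = Suc j"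
    using vs by (auto simp: induced_path_def)
  have reach: "(probe_step E N)\<^sup>*\<^sup>* {hd vs} (set (take (Suc k) vs))" if "k < length vs" for k
    using that
  proof (induction k)
    case 0
    then show ?case using ne by (cases vs) auto
  next
    case (Suc k)
    let ?B = "set (take (Suc k) vs)"
    have mem: "vs ! j \<in> ?B \<longleftrightarrow> j \<le> k" if "j < length vs" for j
      using that dist Suc.prems by (auto simp: in_set_conv_nth nth_eq_iff_index_eq less_Suc_eq_le)
    have "{x. E (vs ! k) x \<and> x \<notin> ?B} = {vs ! Suc k}"
    proof (intro set_eqI iffI)
      fix x assume x: "x \<in> {x. E (vs ! k) x \<and> x \<notin> ?B}"
      obtain j where j: "j < length vs" "x = vs ! j" using vs(2) by (metis UNIV_I in_set_conv_nth)
      then show "x \<in> {vs ! Suc k}" using x ind[of k j] mem[of j] Suc.prems by auto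
    qed (use ind[of k "Suc k"] mem[of "Suc k"] Suc.prems in auto)
    moreover have "vs ! k \<in> ?B" using mem[of k] Suc.prems by simp
    moreover have "N \<subseteq> ?B" if "vs ! k \<in> N"
      using that N \<open>vs ! k \<in> ?B\<close> card_le_Suc0_iff_eq[of N] by auto
    ultimately have "probe_forces E N ?B (vs ! k) (vs ! Suc k)"
      unfolding probe_forces_def by blast
    moreover have "set (take (Suc (Suc k)) vs) = insert (vs ! Suc k) ?B"
      using Suc.prems by (simp add: take_Suc_conv_app_nth[of "Suc k"])
    ultimately have "probe_step E N ?B (set (take (Suc (Suc k)) vs))"
      unfolding probe_step_def by blast
    then show ?case using Suc by simp
  qed
  from reach[of "length vs - 1"] show ?thesis
    using ne vs(2) by (simp add: probe_zero_forcing_set_def)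
qed

lemma probe_zero_forcing_number_le:
  assumes "probe_zero_forcing_set E N B"
  shows "probe_zero_forcing_number E N \<le> card B"
  unfolding probe_zero_forcing_number_def using assms by (intro Min_le) auto

lemma ex_minimum_forcing_set:
  "\<exists>B. probe_zero_forcing_set E N B \<and> card B = probe_zero_forcing_number E N"
proof -
  have "probe_zero_forcing_number E N \<in> card ` {B. probe_zero_forcing_set E N B}"
    unfolding probe_zero_forcing_number_def
    using probe_zero_forcing_set_UNIV[of E N] by (intro Min_in) auto
  then show ?thesis by force
qed

lemma not_path_if_forcing_number_gt_1:
  assumes "probe_zero_forcing_number E N > 1" "card N \<le> 1"
  shows "\<not> path_graph E"
proof
  assume "path_graph E"
  then obtain vs where "induced_path E vs" "set vs = UNIV" by (auto simp: path_graph_def)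
  then have "probe_zero_forcing_number E N \<le> card {hd vs}"
    using path_end_forces assms(2) by (intro probe_zero_forcing_number_le) blast
  then show False using assms(1) by simp
qed

text \<open>When \<open>G\<close> itself is a path, the second null vector comes from an edge added inside \<open>N\<close>.\<close>

lemma ex_probe_matrix_nullity_ge_2:
  fixes E :: "'v::finite \<Rightarrow> 'v \<Rightarrow> bool"
  assumes E: "simple_graph E" and N: "independent_set E N"
    and Z: "probe_zero_forcing_number E N > 1"
  shows "\<exists>A\<in>probe_matrices E N. nullity A \<ge> 2"
proof (rule ccontr)
  assume "\<not> ?thesis"
  then have small: "\<forall>A\<in>graph_matrices H. nullity A < 2" if "H \<in> probe_completions E N" for H
    using that by (auto simp: probe_matrices_def not_le)
  have E0: "E \<in> probe_completions E N" using E by (auto simp: probe_completions_def)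
  have "path_graph E" using path_graph_if_nullity_le_1[OF E small[OF E0]] .
  then have "card N > 1" using not_path_if_forcing_number_gt_1[OF Z] by linarith
  then obtain p q where pq: "p \<in> N" "q \<in> N" "p \<noteq> q"
    using card_le_Suc0_iff_eq[of N] by fastforce
  define H where "H x y \<longleftrightarrow> E x y \<or> {x, y} = {p, q}" for x y
  have H: "simple_graph H"
    using E pq by (auto simp: H_def simple_graph_def symp_def irreflp_def insert_commute)
  have "H \<in> probe_completions E N"
    using H pq by (auto simp: probe_completions_def H_def doubleton_eq_iff)
  then have "\<not> (delete_edge H p q)\<^sup>*\<^sup>* p q"
    by (intro bridge_if_nullity_le_1[OF H small]) (simp_all add: H_def)
  moreover have "delete_edge H p q x y" if "E x y" for x y
    using that N pq by (auto simp: delete_edge_def H_def independent_set_def doubleton_eq_iff)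
  then have "(delete_edge H p q)\<^sup>*\<^sup>* p q"
    using connected_if_nullity_le_1[OF E small[OF E0], of p q]
    by (metis mono_rtranclp)
  ultimately show False by simp
qed

theorem proposition3p8:
  fixes E :: "'v::finite \<Rightarrow> 'v \<Rightarrow> bool" and N :: "'v set"
  assumes "simple_graph E"
    and "independent_set E N"
    and "probe_zero_forcing_number E N = 2"
  shows "probe_zero_forcing_number E N = probe_max_nullity E N
    \<and> probe_max_nullity E N = 2
    \<and> two_parallel_paths E
    \<and> (card N \<le> 1 \<longrightarrow> \<not> path_graph E)"
proof -
  obtain B where B: "probe_zero_forcing_set E N B" "card B = 2"
    using ex_minimum_forcing_set[of E N] assms(3) by auto
  have upper: "nullity A \<le> 2" if "A \<in> probe_matrices E N" for A
    using nullity_le_card_forcing_set[OF that B(1)] B(2) by simp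
  obtain A where A: "A \<in> probe_matrices E N" "nullity A \<ge> 2"
    using ex_probe_matrix_nullity_ge_2[OF assms(1,2)] assms(3) by auto
  have "probe_max_nullity E N = 2"
    unfolding probe_max_nullity_def
  proof (rule Max_eqI)
    show "2 \<in> nullity ` probe_matrices E N"
      using A upper[OF A(1)] by (intro image_eqI[of _ _ A]) auto
  qed (use upper finite_nullities in auto)
  then show ?thesis
    using two_parallel_paths_if_forcing_pair[OF assms(1) B] not_path_if_forcing_number_gt_1[of E N]
      assms(3) by simp
qed

end
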